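(* For every integer $r\ge 3$, the number $\frac{54\, r!}{25\, r^r}$ is a non-jump for $r$.
   Context: An $r$-uniform graph $G$ is a finite set $V(G)$ of vertices together with a set $E(G)\subseteq\binom{V(G)}{r}$ of edges, where $\binom{V}{r}$ denotes the family of all $r$-subsets of $V$. Its density is $d(G)=|E(G)|/\binom{|V(G)|}{r}$. A real number $\alpha\in[0,1)$ is a jump for an integer $r\ge 2$ if there exists a constant $c>0$ such that for any $\epsilon>0$ and any integer $m\ge r$ there exists an integer $n_0(\epsilon,m)$ such that any $r$-uniform graph with $n>n_0(\epsilon,m)$ vertices and density $\ge\alpha+\epsilon$ contains a subgraph with $m$ vertices and density $\ge\alpha+c$. A number in $[0,1)$ that is not a jump for $r$ is called a non-jump for $r$. *)

theory Defs
  imports Complex_Main "HOL-Library.Ramsey"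
begin

text \<open>A hypergraph is given by its vertex set and its edge set; \<^term>\<open>nsets V r\<close> is the
  family of all \<open>r\<close>-subsets of \<open>V\<close>.\<close>

type_synonym 'a hgraph = "'a set \<times> 'a set set"

abbreviation verts :: "'a hgraph \<Rightarrow> 'a set" where
  "verts G \<equiv> fst G"

abbreviation edges :: "'a hgraph \<Rightarrow> 'a set set" where
  "edges G \<equiv> snd G"

definition uniform_graph :: "nat \<Rightarrow> 'a hgraph \<Rightarrow> bool" where
  "uniform_graph r G \<longleftrightarrow> finite (verts G) \<and> edges G \<subseteq> nsets (verts G) r"

text \<open>With fewer than \<open>r\<close> vertices the quotient is \<open>0 / 0 = 0\<close>.\<close>

definition density :: "nat \<Rightarrow> 'a hgraph \<Rightarrow> real" where
  "density r G = real (card (edges G)) / real (card (verts G) choose r)"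

definition subgraph :: "nat \<Rightarrow> 'a hgraph \<Rightarrow> 'a hgraph \<Rightarrow> bool" where
  "subgraph r H G \<longleftrightarrow> uniform_graph r H \<and> verts H \<subseteq> verts G \<and> edges H \<subseteq> edges G"

text \<open>The graphs range over those with vertices in \<^typ>\<open>nat\<close>; every finite graph is isomorphic
  to one of these, and density and containment are invariant under isomorphism.\<close>

definition jump :: "nat \<Rightarrow> real \<Rightarrow> bool" where
  "jump r \<alpha> \<longleftrightarrow> r \<ge> 2 \<and> 0 \<le> \<alpha> \<and> \<alpha> < 1 \<and>
     (\<exists>c::real. c > 0 \<and>
        (\<forall>\<epsilon>::real. \<forall>m::nat. \<epsilon> > 0 \<and> m \<ge> r \<longrightarrow>
           (\<exists>n0::nat. \<forall>G :: nat hgraph.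
              uniform_graph r G \<and> card (verts G) > n0 \<and> density r G \<ge> \<alpha> + \<epsilon> \<longrightarrow>
              (\<exists>H. subgraph r H G \<and> card (verts H) = m \<and> density r H \<ge> \<alpha> + c))))"

definition non_jump :: "nat \<Rightarrow> real \<Rightarrow> bool" where
  "non_jump r \<alpha> \<longleftrightarrow> r \<ge> 2 \<and> 0 \<le> \<alpha> \<and> \<alpha> < 1 \<and> \<not> jump r \<alpha>"

end

theory Submission
  imports Defs "HOL-Analysis.Convex" "HOL-Library.FuncSet" "HOL-Library.Countable"
begin

text \<open>
For \<open>r = 3\<close> the number is \<open>12/25\<close>. It comes from the polynomial \<open>x y z + x\<^sup>2 y/2 + y\<^sup>2 z/2\<close>, whose maximum on
the simplex is \<open>2/25\<close>, attained at \<open>(2/5, 2/5, 1/5)\<close>. The polynomial describes the 3-graphs on three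
parts \<open>V1, V2, V3\<close> whose edges meet the parts in \<open>(1, 1, 1)\<close>, \<open>(2, 1, 0)\<close> or \<open>(0, 2, 1)\<close> vertices.
With parts of sizes \<open>2 t, 2 t, t\<close> such a graph falls short of \<open>2/25 (5 t) ^ 3\<close> edges by \<open>3 t\<^sup>2\<close>,
because the two vertices that an edge has in one part must be distinct.

Now add a system \<open>A\<close> of more than \<open>3 t\<^sup>2\<close> triples inside \<open>V1\<close>. The Lagrangian of the resulting pattern
is larger than \<open>2/25\<close>. Nevertheless \<open>A\<close> can be chosen so sparse locally that any \<open>q \<le> m\<close>
vertices span at most \<open>q - 2\<close> of its triples (\<open>ex_locally_sparse\<close>, by the deletion method). On \<open>m\<close>
vertices the triples then weigh at most \<open>a b (x - a - b)\<close>, where \<open>a\<close> and \<open>b\<close> are the two largest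
weights in \<open>V1\<close> and \<open>x\<close> is the weight of \<open>V1\<close> (\<open>lagr_locally_sparse_le\<close>), whereas the missing pairs with
equal vertices cost at least \<open>y (a\<^sup>2 + b\<^sup>2)/2\<close>. At the maximum \<open>x = y\<close>, so the cost wins there, and it
turns out that the bound \<open>2/25\<close> persists everywhere (\<open>pattern_with_gain_le\<close>). Thus the density above
\<open>12/25\<close> cannot be seen on \<open>m\<close> vertices, and blowing up the pattern shows that \<open>12/25\<close> is a non-jump
(\<open>non_jumpI\<close>).

For \<open>r > 3\<close> the same \<open>r - 3\<close> new vertices are added to every edge. By the inequality of arithmetic and
geometric means this multiplies every Lagrangian by \<open>27 / r ^ r\<close> (\<open>prod_mult_cube_le\<close>), so the
threshold \<open>2/25\<close> becomes \<open>54 / (25 r ^ r)\<close>.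
\<close>

section \<open>Blow-ups and the criterion for non-jumps\<close>

text \<open>The maximum of this polynomial over the simplex is the Lagrangian of \<open>E\<close>. Its value at a vector
of natural numbers is the number of edges of the blow-up in which each vertex \<open>i\<close> is replaced by
\<open>x i\<close> copies; only such vectors occur here.\<close>

definition lagr :: "'a set set \<Rightarrow> ('a \<Rightarrow> nat) \<Rightarrow> nat" where
  "lagr E x = (\<Sum>e\<in>E. \<Prod>i\<in>e. x i)"

lemma lagr_scale:
  assumes "E \<subseteq> nsets I r"
  shows "lagr E (\<lambda>i. k * x i) = k ^ r * lagr E x"
proof -
  have "(\<Prod>i\<in>e. k * x i) = k ^ r * (\<Prod>i\<in>e. x i)" if "e \<in> E" for e
    using that assms by (auto simp: prod.distrib nsets_def)
  then show ?thesis by (simp add: lagr_def sum_distrib_left)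
qed

lemma card_transversals:
  assumes "finite V" "finite e"
  shows "card {f. f \<subseteq> V \<and> inj_on \<pi> f \<and> \<pi> ` f = e} = (\<Prod>i\<in>e. card {v\<in>V. \<pi> v = i})"
proof -
  let ?P = "\<Pi>\<^sub>E i\<in>e. {v\<in>V. \<pi> v = i}"
  have inj: "inj_on (\<lambda>g. g ` e) ?P"
  proof (rule inj_onI)
    fix g h assume g: "g \<in> ?P" and h: "h \<in> ?P" and eq: "g ` e = h ` e"
    show "g = h"
    proof (rule PiE_ext[OF g h])
      fix i assume i: "i \<in> e"
      then have "g i \<in> h ` e" using eq by blast
      then obtain j where j: "j \<in> e" "g i = h j" by blast
      have "\<pi> (g i) = i" using PiE_mem[OF g i] by simp
      moreover have "\<pi> (h j) = j" using PiE_mem[OF h j(1)] by simp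
      ultimately show "g i = h i" using j by simp
    qed
  qed
  have im: "(\<lambda>g. g ` e) ` ?P = {f. f \<subseteq> V \<and> inj_on \<pi> f \<and> \<pi> ` f = e}"
  proof (intro equalityI subsetI)
    fix f assume "f \<in> (\<lambda>g. g ` e) ` ?P"
    then obtain g where g: "g \<in> ?P" "f = g ` e" by blast
    have gi: "g i \<in> V" "\<pi> (g i) = i" if "i \<in> e" for i
      using PiE_mem[OF g(1) that] by auto
    show "f \<in> {f. f \<subseteq> V \<and> inj_on \<pi> f \<and> \<pi> ` f = e}"
      using gi g(2) by (auto simp: inj_on_def image_iff)
  next
    fix f assume f: "f \<in> {f. f \<subseteq> V \<and> inj_on \<pi> f \<and> \<pi> ` f = e}"
    define g where "g = restrict (inv_into f \<pi>) e"
    have 1: "inv_into f \<pi> i \<in> f" "\<pi> (inv_into f \<pi> i) = i" if "i \<in> e" for i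
      using that f by (auto intro: inv_into_into f_inv_into_f)
    have "g \<in> ?P" using 1 f by (auto simp: g_def)
    moreover have "inv_into f \<pi> ` (\<pi> ` f) = f" using f by (intro inv_into_image_cancel) auto
    then have "g ` e = f" using f by (simp add: g_def)
    ultimately show "f \<in> (\<lambda>g. g ` e) ` ?P" by blast
  qed
  show ?thesis
    using card_image[OF inj] assms(2) by (simp add: im card_PiE)
qed

text \<open>For a map \<open>\<pi>\<close> to the vertices of a pattern, the sets that \<open>\<pi>\<close> maps injectively onto edges of the
pattern are the edges of the blow-up with the fibres of \<open>\<pi>\<close> as parts.\<close>

lemma card_blowup:
  assumes "finite V" "finite E" "\<And>e. e \<in> E \<Longrightarrow> finite e"
  shows "card {f. f \<subseteq> V \<and> inj_on \<pi> f \<and> \<pi> ` f \<in> E} = lagr E (\<lambda>i. card {v\<in>V. \<pi> v = i})"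
proof -
  let ?T = "\<lambda>e. {f. f \<subseteq> V \<and> inj_on \<pi> f \<and> \<pi> ` f = e}"
  have "{f. f \<subseteq> V \<and> inj_on \<pi> f \<and> \<pi> ` f \<in> E} = (\<Union>e\<in>E. ?T e)" by auto
  also have "card \<dots> = (\<Sum>e\<in>E. card (?T e))"
    using assms by (intro card_UN_disjoint) auto
  also have "\<dots> = lagr E (\<lambda>i. card {v\<in>V. \<pi> v = i})"
    unfolding lagr_def using assms by (intro sum.cong) (auto simp: card_transversals)
  finally show ?thesis .
qed

lemma ex_fibres:
  fixes w :: "'a::countable \<Rightarrow> nat"
  assumes "finite I"
  obtains V :: "nat set" and \<pi> where
    "finite V" "\<pi> ` V \<subseteq> I" "\<And>i. i \<in> I \<Longrightarrow> card {v\<in>V. \<pi> v = i} = w i"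
proof -
  define V where "V = to_nat ` Sigma I (\<lambda>i. {..<w i})"
  define \<pi> where "\<pi> = (\<lambda>v. fst (from_nat v :: 'a \<times> nat))"
  have "{v\<in>V. \<pi> v = i} = to_nat ` ({i} \<times> {..<w i})" if "i \<in> I" for i
    using that by (auto simp: V_def \<pi>_def)
  then have "card {v\<in>V. \<pi> v = i} = w i" if "i \<in> I" for i
    using that by (simp add: card_image)
  moreover have "\<pi> ` V \<subseteq> I" by (auto simp: V_def \<pi>_def)
  ultimately show ?thesis using that[of V \<pi>] assms by (simp add: V_def)
qed

lemma fact_binomial_ge:
  assumes "r \<le> m"
  shows "(real m - real r) ^ r \<le> fact r * real (m choose r)"
proof -
  have "fact r * real (m choose r) = (\<Prod>i = 0..<r. real m - real i)"
    using gbinomial_mult_fact[of r "real m"] by (simp add: binomial_gbinomial)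
  moreover have "(\<Prod>i = 0..<r. real m - real r) \<le> (\<Prod>i = 0..<r. real m - real i)"
    using assms by (intro prod_mono) auto
  ultimately show ?thesis by simp
qed

text \<open>Bounds on Lagrangians control \<open>|E| / m ^ r\<close>, while densities have \<open>m choose r\<close> in the denominator. For
large \<open>m\<close> the difference between the two normalisations is smaller than any given \<open>c\<close>.\<close>

lemma ex_large_falling_factorial:
  fixes \<alpha> c :: real
  assumes "0 \<le> \<alpha>" "0 < c"
  shows "\<exists>m\<ge>r. \<alpha> * real m ^ r < (\<alpha> + c) * (fact r * real (m choose r))"
proof -
  have "(\<lambda>m. (\<alpha> + c) * (1 - real r / real m) ^ r) \<longlonglongrightarrow> (\<alpha> + c) * (1 - 0) ^ r"
    by (intro tendsto_intros lim_const_over_n)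
  moreover have "\<alpha> < (\<alpha> + c) * (1 - 0) ^ r" using assms by simp
  ultimately have "\<forall>\<^sub>F m in sequentially. \<alpha> < (\<alpha> + c) * (1 - real r / real m) ^ r"
    by (rule order_tendstoD)
  then have "\<forall>\<^sub>F m in sequentially. \<alpha> < (\<alpha> + c) * (1 - real r / real m) ^ r \<and> m \<ge> r + 1"
    using eventually_ge_at_top[of "r + 1"] by eventually_elim simp
  then obtain m where m: "\<alpha> < (\<alpha> + c) * (1 - real r / real m) ^ r" "m \<ge> r + 1"
    using eventually_happens'[OF sequentially_bot] by blast
  have "\<alpha> * real m ^ r < (\<alpha> + c) * (1 - real r / real m) ^ r * real m ^ r"
    using m by (intro mult_strict_right_mono) auto
  also have "(1 - real r / real m) ^ r * real m ^ r = (real m - real r) ^ r"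
    using m by (simp flip: power_mult_distrib add: left_diff_distrib)
  then have "(\<alpha> + c) * (1 - real r / real m) ^ r * real m ^ r = (\<alpha> + c) * (real m - real r) ^ r"
    by (simp add: mult.assoc)
  also have "\<dots> \<le> (\<alpha> + c) * (fact r * real (m choose r))"
    using m assms by (intro mult_left_mono fact_binomial_ge) auto
  finally show ?thesis using m by (intro exI[of _ m]) auto
qed

text \<open>The criterion of Frankl and Roedl. A pattern whose Lagrangian exceeds \<open>\<alpha> / r!\<close> has arbitrarily large
blow-ups of density at least \<open>\<alpha> + \<epsilon>\<close> for a fixed \<open>\<epsilon>\<close>. A subgraph of such a blow-up on \<open>m\<close> vertices is
contained in a blow-up of at most \<open>m\<close> vertices of the pattern; if the Lagrangian of every such part
is at most \<open>\<alpha> / r!\<close>, then its density is at most \<open>\<alpha> m ^ r / (r! (m choose r))\<close>, which is below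
\<open>\<alpha> + c\<close> as soon as \<open>m\<close> is large.\<close>

theorem non_jumpI:
  fixes \<alpha> :: real
  assumes "r \<ge> 2" "0 \<le> \<alpha>" "\<alpha> < 1"
    and pattern: "\<And>m. \<exists>(I :: 'a::countable set) E w. finite I \<and> E \<subseteq> nsets I r \<and>
      \<alpha> * real (\<Sum>i\<in>I. w i) ^ r < fact r * real (lagr E w) \<and>
      (\<forall>x. card {i\<in>I. x i > 0} \<le> m \<longrightarrow> fact r * real (lagr E x) \<le> \<alpha> * real (\<Sum>i\<in>I. x i) ^ r)"
  shows "non_jump r \<alpha>"
proof -
  have False if "jump r \<alpha>"
  proof -
    from that obtain c :: real where "c > 0" and
      c: "\<And>\<epsilon> m. \<epsilon> > 0 \<Longrightarrow> m \<ge> r \<Longrightarrow> \<exists>n0::nat. \<forall>G :: nat hgraph.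
              uniform_graph r G \<and> card (verts G) > n0 \<and> density r G \<ge> \<alpha> + \<epsilon> \<longrightarrow>
              (\<exists>H. subgraph r H G \<and> card (verts H) = m \<and> density r H \<ge> \<alpha> + c)"
      unfolding jump_def by blast
    obtain m where m: "m \<ge> r" "\<alpha> * real m ^ r < (\<alpha> + c) * (fact r * real (m choose r))"
      using ex_large_falling_factorial[OF assms(2) \<open>c > 0\<close>] by blast
    from pattern[of m] obtain I :: "'a set" and E w where
      I: "finite I" and E: "E \<subseteq> nsets I r" and
      w: "\<alpha> * real (\<Sum>i\<in>I. w i) ^ r < fact r * real (lagr E w)" and
      x: "\<And>x. card {i\<in>I. x i > 0} \<le> m \<Longrightarrow>
            fact r * real (lagr E x) \<le> \<alpha> * real (\<Sum>i\<in>I. x i) ^ r"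
      by blast
    have Efin: "finite E" "\<And>e. e \<in> E \<Longrightarrow> finite e"
      using E I finite_imp_finite_nsets[OF I] by (auto simp: nsets_def intro: finite_subset)
    define S where "S = (\<Sum>i\<in>I. w i)"
    have "S > 0"
    proof (rule ccontr)
      assume "\<not> S > 0"
      then have 0: "w i = 0" if "i \<in> I" for i using I that by (simp add: S_def)
      have "(\<Prod>i\<in>e. w i) = 0" if "e \<in> E" for e
      proof -
        have e: "e \<subseteq> I" "card e = r" "finite e" using E that by (auto simp: nsets_def)
        then obtain i where "i \<in> e" using assms(1) by fastforce
        then show ?thesis using e 0 by auto
      qed
      then have "lagr E w = 0" by (simp add: lagr_def)
      moreover have "0 \<le> \<alpha> * real S ^ r" using assms(2) by simp
      ultimately show False using w by (simp add: S_def)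
    qed
    define \<epsilon> where "\<epsilon> = fact r * real (lagr E w) / real S ^ r - \<alpha>"
    have "\<epsilon> > 0" using w \<open>S > 0\<close> by (simp add: \<epsilon>_def S_def[symmetric] field_simps)
    from c[OF this m(1)] obtain n0 where n0: "\<And>G :: nat hgraph.
        uniform_graph r G \<Longrightarrow> card (verts G) > n0 \<Longrightarrow> density r G \<ge> \<alpha> + \<epsilon> \<Longrightarrow>
        (\<exists>H. subgraph r H G \<and> card (verts H) = m \<and> density r H \<ge> \<alpha> + c)"
      by blast
    \<comment> \<open>The summand \<open>r\<close> ensures that the blow-up has at least \<open>r\<close> vertices, so that its density is a
      proper quotient.\<close>
    define k where "k = n0 + r + 1"
    obtain V :: "nat set" and \<pi> where V: "finite V" "\<pi> ` V \<subseteq> I"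
      and fib: "\<And>i. i \<in> I \<Longrightarrow> card {v\<in>V. \<pi> v = i} = k * w i"
      using ex_fibres[OF I, of "\<lambda>i. k * w i"] by blast
    define G where "G = (V, {f. f \<subseteq> V \<and> inj_on \<pi> f \<and> \<pi> ` f \<in> E})"
    have card_fibres: "card U = (\<Sum>i\<in>I. card {v\<in>U. \<pi> v = i})" if "U \<subseteq> V" for U
    proof -
      have "card U = card (\<Union>i\<in>I. {v\<in>U. \<pi> v = i})"
        using that V by (intro arg_cong[where f=card]) auto
      also have "\<dots> = (\<Sum>i\<in>I. card {v\<in>U. \<pi> v = i})"
        using that V I by (intro card_UN_disjoint) (auto intro: finite_subset)
      finally show ?thesis .
    qed
    have cV: "card V = k * S"
      using card_fibres[of V] fib by (simp add: S_def sum_distrib_left)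
    have cVk: "card V \<ge> k" using cV \<open>S > 0\<close> by simp
    have cong: "lagr E y = lagr E z" if "\<And>i. i \<in> I \<Longrightarrow> y i = z i" for y z
      unfolding lagr_def
    proof (rule sum.cong)
      fix e assume "e \<in> E"
      then have "e \<subseteq> I" using E by (auto simp: nsets_def)
      then show "(\<Prod>i\<in>e. y i) = (\<Prod>i\<in>e. z i)" using that by (intro prod.cong) auto
    qed simp
    have "uniform_graph r G"
      unfolding uniform_graph_def
    proof
      show "finite (verts G)" using V by (simp add: G_def)
      show "edges G \<subseteq> nsets (verts G) r"
      proof
        fix f assume "f \<in> edges G"
        then have f: "f \<subseteq> V" "inj_on \<pi> f" "\<pi> ` f \<in> E" by (auto simp: G_def)
        then have "card f = r" using E card_image[OF f(2)] by (auto simp: nsets_def)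
        then show "f \<in> nsets (verts G) r"
          using f V by (auto simp: G_def nsets_def intro: finite_subset)
      qed
    qed
    moreover have "card (verts G) > n0" using cVk by (simp add: G_def k_def)
    moreover have "density r G \<ge> \<alpha> + \<epsilon>"
    proof -
      have "card (edges G) = lagr E (\<lambda>i. k * w i)"
        using card_blowup[OF V(1) Efin, of \<pi>] cong[OF fib] by (simp add: G_def)
      then have eG: "card (edges G) = k ^ r * lagr E w" by (simp add: lagr_scale[OF E])
      have pos: "card V choose r > 0" using cVk by (simp add: k_def)
      have "(card V choose r) * fact r \<le> card V ^ r" by (rule binomial_fact_pow)
      then have "real ((card V choose r) * fact r) \<le> real (card V ^ r)" by (simp only: of_nat_le_iff)
      then have le: "real (card V choose r) * fact r \<le> real k ^ r * real S ^ r"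
        by (simp add: cV power_mult_distrib)
      have "(\<alpha> + \<epsilon>) * real (card V choose r) =
          real (lagr E w) * (real (card V choose r) * fact r) / real S ^ r"
        by (simp add: \<epsilon>_def)
      also have "\<dots> \<le> real (lagr E w) * (real k ^ r * real S ^ r) / real S ^ r"
        using le by (intro divide_right_mono mult_left_mono) auto
      also have "\<dots> = real (card (edges G))" using \<open>S > 0\<close> by (simp add: eG)
      finally have "(\<alpha> + \<epsilon>) * real (card V choose r) \<le> real (card (edges G))" .
      then show ?thesis using pos by (simp add: density_def G_def pos_le_divide_eq)
    qed
    ultimately obtain H where H: "subgraph r H G" "card (verts H) = m" "density r H \<ge> \<alpha> + c"
      using n0 by blast
    define U where "U = verts H"
    have U: "U \<subseteq> V" and eH: "edges H \<subseteq> edges G" "edges H \<subseteq> nsets U r" and Ufin: "finite U"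
      using H(1) by (auto simp: subgraph_def uniform_graph_def G_def U_def)
    define x where "x = (\<lambda>i. card {v\<in>U. \<pi> v = i})"
    have "edges H \<subseteq> {f. f \<subseteq> U \<and> inj_on \<pi> f \<and> \<pi> ` f \<in> E}"
      using eH by (auto simp: G_def nsets_def)
    moreover have "finite {f. f \<subseteq> U \<and> inj_on \<pi> f \<and> \<pi> ` f \<in> E}"
      using Ufin by (intro finite_subset[OF _ finite_Pow_iff[THEN iffD2, OF Ufin]]) auto
    ultimately have "card (edges H) \<le> card {f. f \<subseteq> U \<and> inj_on \<pi> f \<and> \<pi> ` f \<in> E}"
      by (rule card_mono[rotated])
    also have "\<dots> = lagr E x" unfolding x_def by (rule card_blowup[OF Ufin Efin])
    finally have "card (edges H) \<le> lagr E x" .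
    then have "fact r * real (card (edges H)) \<le> fact r * real (lagr E x)"
      by simp
    also have "\<dots> \<le> \<alpha> * real (\<Sum>i\<in>I. x i) ^ r"
    proof (rule x)
      have "{i\<in>I. x i > 0} \<subseteq> \<pi> ` U" by (auto simp: x_def card_gt_0_iff)
      then have "card {i\<in>I. x i > 0} \<le> card (\<pi> ` U)" using Ufin by (intro card_mono) auto
      also have "\<dots> \<le> m" using card_image_le[OF Ufin, of \<pi>] H(2) by (simp add: U_def)
      finally show "card {i\<in>I. x i > 0} \<le> m" .
    qed
    also have "(\<Sum>i\<in>I. x i) = m" using card_fibres[OF U] H(2) by (simp add: x_def U_def)
    also have "\<alpha> * real m ^ r < (\<alpha> + c) * (fact r * real (m choose r))" by (rule m)
    finally have "real (card (edges H)) < (\<alpha> + c) * real (m choose r)"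
      by (simp add: mult.left_commute)
    moreover have "real (m choose r) > 0" using m(1) by simp
    ultimately show False using H(2,3) by (simp add: density_def pos_le_divide_eq)
  qed
  then show ?thesis using assms by (auto simp: non_jump_def)
qed

section \<open>Edge polynomials of joins\<close>

text \<open>For families on disjoint vertex sets this operation multiplies the edge polynomials.\<close>

definition join :: "'a set set \<Rightarrow> 'a set set \<Rightarrow> 'a set set" where
  "join P Q = (\<lambda>(p, q). p \<union> q) ` (P \<times> Q)"

lemma join_nsets:
  assumes "P \<subseteq> nsets A k" "Q \<subseteq> nsets B l" "A \<inter> B = {}"
  shows "join P Q \<subseteq> nsets (A \<union> B) (k + l)"
proof -
  have "card (p \<union> q) = k + l" if "p \<in> P" "q \<in> Q" for p q
  proof -
    have "p \<subseteq> A" "q \<subseteq> B" "finite p" "finite q" "card p = k" "card q = l"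
      using that assms by (auto simp: nsets_def)
    moreover from this have "p \<inter> q = {}" using assms(3) by blast
    ultimately show ?thesis by (simp add: card_Un_disjoint)
  qed
  then show ?thesis using assms by (auto simp: join_def nsets_def)
qed

lemma lagr_join:
  assumes "P \<subseteq> nsets A k" "Q \<subseteq> nsets B l" "A \<inter> B = {}"
  shows "lagr (join P Q) x = lagr P x * lagr Q x"
proof -
  have sub: "p \<subseteq> A" "finite p" if "p \<in> P" for p using that assms by (auto simp: nsets_def)
  have sub': "q \<subseteq> B" "finite q" if "q \<in> Q" for q using that assms by (auto simp: nsets_def)
  have inj: "inj_on (\<lambda>(p, q). p \<union> q) (P \<times> Q)"
  proof (rule inj_onI, clarify)
    fix p q p' q' assume *: "p \<in> P" "q \<in> Q" "p' \<in> P" "q' \<in> Q" "p \<union> q = p' \<union> q'"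
    have "p = (p \<union> q) \<inter> A" "p' = (p' \<union> q') \<inter> A" "q = (p \<union> q) \<inter> B" "q' = (p' \<union> q') \<inter> B"
      using sub[OF *(1)] sub[OF *(3)] sub'[OF *(2)] sub'[OF *(4)] assms(3) by auto
    then show "p = p' \<and> q = q'" using *(5) by simp
  qed
  have "lagr (join P Q) x = (\<Sum>(p, q)\<in>P \<times> Q. \<Prod>i\<in>p \<union> q. x i)"
    unfolding lagr_def join_def sum.reindex[OF inj] by (intro sum.cong) auto
  also have "\<dots> = (\<Sum>(p, q)\<in>P \<times> Q. (\<Prod>i\<in>p. x i) * (\<Prod>i\<in>q. x i))"
  proof (intro sum.cong refl, clarify)
    fix p q assume "p \<in> P" "q \<in> Q"
    then show "(\<Prod>i\<in>p \<union> q. x i) = (\<Prod>i\<in>p. x i) * (\<Prod>i\<in>q. x i)"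
      using sub[of p] sub'[of q] assms(3) by (intro prod.union_disjoint) auto
  qed
  also have "\<dots> = lagr P x * lagr Q x"
    by (simp add: lagr_def sum_product sum.cartesian_product)
  finally show ?thesis .
qed

lemma lagr_Un:
  assumes "finite P" "finite Q" "P \<inter> Q = {}"
  shows "lagr (P \<union> Q) x = lagr P x + lagr Q x"
  unfolding lagr_def using assms by (rule sum.union_disjoint)

lemma lagr_singletons: "lagr (nsets V 1) x = sum x V"
proof -
  have "nsets V 1 = (\<lambda>v. {v}) ` V" by (auto simp: nsets_def card_1_singleton_iff)
  then show ?thesis by (simp add: lagr_def sum.reindex)
qed

lemma lagr_pairs:
  assumes "finite V"
  shows "2 * lagr (nsets V 2) x + (\<Sum>v\<in>V. (x v)^2) = (sum x V)^2"
  using assms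
proof (induction V)
  case empty
  then show ?case by (simp add: lagr_def nsets_def)
next
  case (insert a V)
  have "nsets (insert a V) 2 = nsets V 2 \<union> join (nsets {a} 1) (nsets V 1)"
  proof (intro equalityI subsetI)
    fix e assume e: "e \<in> nsets (insert a V) 2"
    show "e \<in> nsets V 2 \<union> join (nsets {a} 1) (nsets V 1)"
    proof (cases "a \<in> e")
      case True
      then have "{a} \<in> nsets {a} 1" "e - {a} \<in> nsets V 1" "e = {a} \<union> (e - {a})"
        using e by (auto simp: nsets_def)
      then show ?thesis unfolding join_def by blast
    qed (use e in \<open>auto simp: nsets_def\<close>)
  next
    fix e assume "e \<in> nsets V 2 \<union> join (nsets {a} 1) (nsets V 1)"
    moreover have "join (nsets {a} 1) (nsets V 1) \<subseteq> nsets ({a} \<union> V) (1 + 1)"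
      using insert(2) by (intro join_nsets) auto
    moreover have "nsets V 2 \<subseteq> nsets (insert a V) 2" by (rule nsets_mono) auto
    ultimately show "e \<in> nsets (insert a V) 2" by (auto simp: numeral_2_eq_2)
  qed
  moreover have "nsets V 2 \<inter> join (nsets {a} 1) (nsets V 1) = {}"
    using insert(2) by (auto simp: nsets_def join_def card_1_singleton_iff)
  ultimately have "lagr (nsets (insert a V) 2) x =
      lagr (nsets V 2) x + lagr (join (nsets {a} 1) (nsets V 1)) x"
    using insert(1) by (simp add: lagr_Un finite_imp_finite_nsets join_def)
  also have "lagr (join (nsets {a} 1) (nsets V 1)) x = x a * sum x V"
    using insert(2) by (subst lagr_join[of _ "{a}" 1 _ V 1]) (auto simp: lagr_singletons[unfolded One_nat_def] )
  finally show ?case using insert by (simp add: power2_eq_square algebra_simps)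
qed

lemma card_Int_join:
  assumes "e \<in> join P Q" "P \<subseteq> nsets A k" "Q \<subseteq> nsets B l" "A \<inter> B = {}"
  shows "card (e \<inter> A) = k"
proof -
  obtain p q where pq: "p \<in> P" "q \<in> Q" "e = p \<union> q" using assms(1) by (auto simp: join_def)
  then have "p \<subseteq> A" "q \<subseteq> B" "card p = k" using assms(2,3) by (auto simp: nsets_def)
  moreover from this have "e \<inter> A = p" using pq(3) assms(4) by blast
  ultimately show ?thesis by simp
qed

section \<open>The inequality for the three-part pattern\<close>

text \<open>Put \<open>T = x + y + z\<close>. For fixed \<open>x\<close> and \<open>y\<close> the left-hand side is linear in \<open>T\<close>, so \<open>T ^ 3\<close> may be replaced
by its tangent \<open>3 T w\<^sup>2 - 2 w ^ 3\<close> at any point \<open>w \<ge> 0\<close>. The best \<open>w\<close> is \<open>sqrt (25/6 (x y + y\<^sup>2/2))\<close>; the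
one used below is the linear approximation to it along the ray \<open>x = y\<close>, which contains the point of
equality \<open>(2, 2, 1)\<close>. The room that this leaves for \<open>x > y\<close> accommodates the cubic term, which
bounds the gain from the triples inside the first part.\<close>

lemma pattern_plus_cube_le:
  fixes x y z :: real
  assumes "x \<ge> y" "y \<ge> 0" "z \<ge> 0"
  shows "x*y*z + x^2*y/2 + y^2*z/2 + (x - y)^3/27 \<le> 2/25 * (x+y+z)^3"
proof -
  define w where "w = 5/6 * (x + 2*y)"
  define T where "T = x + y + z"
  have w: "w \<ge> 0" using assms by (simp add: w_def)
  have T: "T \<ge> 0" using assms by (simp add: T_def)
  have "T^3 - (3*T*w^2 - 2*w^3) = (T - w)^2 * (T + 2*w)"
    by (simp add: power2_eq_square power3_eq_cube algebra_simps)
  moreover have "(T - w)^2 * (T + 2*w) \<ge> 0" using w T by simp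
  ultimately have 1: "T^3 \<ge> 3*T*w^2 - 2*w^3" by linarith
  have "2/25 * (3*T*w^2 - 2*w^3) - (x*y*z + x^2*y/2 + y^2*z/2 + (x - y)^3/27)
      = z * (x - y)^2/6 + (x - y)^3/27"
    by (simp add: w_def T_def power2_eq_square power3_eq_cube algebra_simps field_simps)
  moreover have "z * (x - y)^2/6 + (x - y)^3/27 \<ge> 0" using assms by simp
  moreover have "2/25 * (3*T*w^2 - 2*w^3) \<le> 2/25 * T^3" using 1 by simp
  ultimately show ?thesis unfolding T_def[symmetric] by linarith
qed

text \<open>The value \<open>2/25\<close> is the maximum on the simplex. For fixed \<open>y\<close> and fixed total weight \<open>T\<close>
the left-hand side is a concave quadratic in \<open>x\<close>, and completing the square leaves a cubic in \<open>y\<close> with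
the double root \<open>2/5 T\<close> and the simple root \<open>4/5 T\<close>. Beyond the latter, \<open>y (x + z)\<close> is at most
\<open>4/25 T\<^sup>2\<close>, which suffices.\<close>

lemma pattern_le:
  fixes x y z :: real
  assumes "x \<ge> 0" "y \<ge> 0" "z \<ge> 0"
  shows "x*y*z + x^2*y/2 + y^2*z/2 \<le> 2/25 * (x+y+z)^3"
proof -
  define T where "T = x + y + z"
  have T: "T \<ge> 0" "x + z = T - y" using assms by (auto simp: T_def)
  show ?thesis
  proof (cases "y \<le> 4/5 * T")
    case True
    have z: "z = T - x - y" by (simp add: T_def)
    have "2/25 * T^3 - (x*y*z + x^2*y/2 + y^2*z/2)
        = 5/8 * ((y - 2/5*T)^2 * (4/5*T - y)) + y/2 * (x - (T - 3/2*y))^2"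
      unfolding z by (simp add: power2_eq_square power3_eq_cube algebra_simps field_simps)
    moreover have "(y - 2/5*T)^2 * (4/5*T - y) \<ge> 0" "y/2 * (x - (T - 3/2*y))^2 \<ge> 0"
      using True assms by auto
    ultimately show ?thesis unfolding T_def[symmetric] by linarith
  next
    case False
    have y: "y = T - x - z" by (simp add: T_def)
    have "x*y*z + x^2*y/2 + y^2*z/2 + (y * z^2 + y^2 * x) / 2 = y * (x + z) * T / 2"
      by (simp add: T_def power2_eq_square algebra_simps field_simps)
    moreover have "(y * z^2 + y^2 * x) / 2 \<ge> 0" using assms by simp
    moreover have "y * (x + z) \<le> 4/25 * T^2"
    proof -
      have "4/25 * T^2 - y * (x + z) = (y - 4/5 * T) * (y - 1/5 * T)"
        unfolding T(2) by (simp add: power2_eq_square algebra_simps field_simps)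
      moreover have "(y - 4/5 * T) * (y - 1/5 * T) \<ge> 0"
        using False T by (intro mult_nonneg_nonneg) auto
      ultimately show ?thesis by linarith
    qed
    then have "y * (x + z) * T \<le> 4/25 * T^2 * T" using T by (intro mult_right_mono) auto
    then have "y * (x + z) * T / 2 \<le> 2/25 * T^3" by (simp add: power2_eq_square power3_eq_cube)
    ultimately show ?thesis unfolding T_def[symmetric] by linarith
  qed
qed

text \<open>By the inequality of arithmetic and geometric means, with equality for \<open>a = b = d / 3\<close>.\<close>

lemma gain_le:
  fixes a b d :: real
  assumes "a \<ge> 0" "b \<ge> 0" "d \<ge> 0"
  shows "a * b * (d - a - b) \<le> d^3 / 27"
proof (cases "a + b \<le> d")
  case True
  define u where "u = (a + b) / 2"
  have "a * b \<le> u^2"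
    using sum_squares_ge_zero[of "a - b" 0] by (simp add: u_def power2_eq_square algebra_simps field_simps)
  then have "a * b * (d - a - b) \<le> u^2 * (d - a - b)" using True by (intro mult_right_mono) auto
  also have "u^2 * (d - a - b) = d^3/27 - 2 * ((u - d/3)^2 * (u + d/6))"
    by (simp add: u_def power2_eq_square power3_eq_cube algebra_simps field_simps)
  also have "\<dots> \<le> d^3/27" using assms by (simp add: u_def)
  finally show ?thesis .
next
  case False
  then have "a * b * (d - a - b) \<le> 0" using assms by (intro mult_nonneg_nonpos) auto
  then show ?thesis using assms by (smt (verit) divide_nonneg_pos zero_le_power)
qed

text \<open>Here \<open>a\<close> and \<open>b\<close> are the weights of two vertices of the first part. The term with \<open>a\<^sup>2 + b\<^sup>2\<close> is the loss
from the missing degenerate edges, and \<open>a b (x - a - b)\<close> is the weight of all triples of the first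
part through both vertices. As \<open>a b \<le> (a\<^sup>2 + b\<^sup>2) / 2\<close>, loss and gain together are at most
\<open>a b (x - y - a - b)\<close>. This is nonpositive for \<open>x \<le> y\<close>, and otherwise at most \<open>((x - y) / 3) ^ 3\<close>.\<close>

lemma pattern_with_gain_le:
  fixes x y z a b :: real
  assumes "x \<ge> 0" "y \<ge> 0" "z \<ge> 0" "a \<ge> 0" "b \<ge> 0"
  shows "x*y*z + (x^2 - (a^2 + b^2))*y/2 + y^2*z/2 + a*b*(x - a - b) \<le> 2/25 * (x+y+z)^3"
proof -
  have "a * b \<le> (a^2 + b^2) / 2"
    using zero_le_power2[of "a - b"] by (simp add: power2_eq_square algebra_simps)
  then have "a * b * y \<le> (a^2 + b^2) / 2 * y" using assms by (intro mult_right_mono)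
  then have loss: "a*b*(x - a - b) - (a^2 + b^2)*y/2 \<le> a * b * ((x - y) - a - b)"
    by (simp add: algebra_simps)
  have split: "(x^2 - (a^2 + b^2))*y/2 = x^2*y/2 - (a^2 + b^2)*y/2" by (simp add: algebra_simps field_simps)
  show ?thesis
  proof (cases "x \<ge> y")
    case True
    then show ?thesis
      using pattern_plus_cube_le[of y x z] gain_le[of a b "x - y"] assms loss split by linarith
  next
    case False
    then have "a * b * ((x - y) - a - b) \<le> 0" using assms by (intro mult_nonneg_nonpos) auto
    then show ?thesis using pattern_le[of x y z] assms loss split by linarith
  qed
qed

section \<open>Locally sparse systems of triples\<close>

text \<open>Choose \<open>n\<^sup>2\<close> triples independently and uniformly. A given set \<open>W\<close> of \<open>q\<close> vertices contains \<open>q - 1\<close>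
given ones of them with probability \<open>O(n ^ (- 3 (q - 1)))\<close>, and there are at most
\<open>n ^ q (n\<^sup>2) ^ (q - 1)\<close> choices of \<open>W\<close> and of the \<open>q - 1\<close> indices. So the expected number of such pairs
is \<open>O(n)\<close> for each \<open>q\<close>, and some choice of triples does as well as the average.\<close>

lemma ex_triples_few_crowded_sets:
  fixes n m :: nat
  assumes "n \<ge> 3"
  shows "\<exists>T \<in> {..<n^2} \<rightarrow>\<^sub>E nsets {..<n} 3.
    real (card {(W, Q). W \<subseteq> {..<n} \<and> card W \<le> m \<and> Q \<subseteq> {..<n^2} \<and> card Q + 1 = card W \<and>
      (\<forall>i\<in>Q. T i \<subseteq> W)}) \<le> real n * (real (m+1) * (27 * real m ^ 3 + 1) ^ m)"
proof -
  define M where M: "M = n^2"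
  define \<T> where "\<T> = nsets {..<n} 3"
  define \<Omega> where "\<Omega> = {..<M} \<rightarrow>\<^sub>E \<T>"
  define bad where "bad T = {(W, Q). W \<subseteq> {..<n} \<and> card W \<le> m \<and> Q \<subseteq> {..<M} \<and> card Q + 1 = card W \<and>
       (\<forall>i\<in>Q. T i \<subseteq> W)}" for T :: "nat \<Rightarrow> nat set"
  define C where "C q = {(W, Q). W \<subseteq> {..<n} \<and> card W = q \<and> Q \<subseteq> {..<M} \<and> card Q + 1 = q}" for q
  \<comment> \<open>The summand \<open>1\<close> makes the base at least \<open>1\<close>, so that \<open>K\<close> bounds all powers up to the \<open>m\<close>-th.\<close>
  define K where "K = (27 * real m ^ 3 + 1) ^ m"
  have finT: "finite \<T>" by (simp add: \<T>_def finite_imp_finite_nsets)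
  have cT: "card \<T> = n choose 3" by (simp add: \<T>_def)
  have posT: "card \<T> > 0" using assms(1) by (simp add: cT)
  have fin\<Omega>: "finite \<Omega>" unfolding \<Omega>_def using finT by (intro finite_PiE) auto
  have c\<Omega>: "card \<Omega> = card \<T> ^ M" unfolding \<Omega>_def by (simp add: card_PiE)
  have finC: "finite (C q)" for q
    by (rule finite_subset[of _ "Pow {..<n} \<times> Pow {..<M}"]) (auto simp: C_def)
  have ge: "real n ^ 3 \<le> 27 * real (card \<T>)"
    using binomial_ge_n_over_k_pow_k[OF assms(1), where 'a = real]
    by (simp add: cT power_divide)
  \<comment> \<open>A triple lies in \<open>W\<close> with probability at most \<open>27 m ^ 3 / n ^ 3\<close>, independently for different
    indices. All probabilities are multiplied by \<open>card \<Omega>\<close>, which turns them into cardinalities.\<close>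
  have prob: "real (card {T\<in>\<Omega>. \<forall>i\<in>Q. T i \<subseteq> W}) * real n ^ (3 * q) \<le> (27 * real m ^ 3) ^ q * real (card \<Omega>)"
    if W: "W \<subseteq> {..<n}" "card W \<le> m" and Q: "Q \<subseteq> {..<M}" "card Q = q" for W Q q
  proof -
    have finW: "finite W" using W finite_subset by auto
    have "e \<in> (if i \<in> Q then nsets W 3 else \<T>) \<longleftrightarrow> e \<in> \<T> \<and> (i \<in> Q \<longrightarrow> e \<subseteq> W)" for e i
      using W(1) unfolding \<T>_def nsets_def by auto
    then have "{T\<in>\<Omega>. \<forall>i\<in>Q. T i \<subseteq> W} = (\<Pi>\<^sub>E i\<in>{..<M}. if i \<in> Q then nsets W 3 else \<T>)"
      using Q(1) unfolding \<Omega>_def by (intro set_eqI) (simp only: mem_Collect_eq PiE_iff, blast)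
    then have "card {T\<in>\<Omega>. \<forall>i\<in>Q. T i \<subseteq> W} = (\<Prod>i<M. if i \<in> Q then card W choose 3 else card \<T>)"
      by (simp add: card_PiE if_distrib[of card] cong: if_cong)
    also have "\<dots> = (card W choose 3) ^ q * card \<T> ^ (M - q)"
    proof -
      have "{..<M} \<inter> {i. i \<in> Q} = Q" "{..<M} \<inter> - {i. i \<in> Q} = {..<M} - Q" using Q by auto
      moreover have "card ({..<M} - Q) = M - q"
        using Q by (simp add: card_Diff_subset finite_subset)
      ultimately show ?thesis using Q(2) by (simp only: prod.If_cases finite_lessThan prod_constant)
    qed
    finally have 1: "card {T\<in>\<Omega>. \<forall>i\<in>Q. T i \<subseteq> W} = (card W choose 3) ^ q * card \<T> ^ (M - q)" .
    have qM: "q \<le> M" using Q card_mono[of "{..<M}" Q] by simp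
    have "card W choose 3 \<le> m ^ 3"
    proof (cases "3 \<le> card W")
      case True
      then have "card W choose 3 \<le> card W ^ 3" by (rule binomial_le_pow)
      also have "\<dots> \<le> m ^ 3" using W by (intro power_mono) auto
      finally show ?thesis .
    qed (simp add: binomial_eq_0)
    then have "(card W choose 3) ^ q \<le> (m ^ 3) ^ q" by (rule power_mono) simp
    then have 2: "real ((card W choose 3) ^ q) \<le> (real m ^ 3) ^ q"
      by (metis of_nat_le_iff of_nat_power)
    have 3: "real n ^ (3 * q) \<le> 27 ^ q * real (card \<T>) ^ q"
      using power_mono[OF ge, of q] by (simp add: power_mult power_mult_distrib)
    have "real (card {T\<in>\<Omega>. \<forall>i\<in>Q. T i \<subseteq> W}) * real n ^ (3 * q)
        \<le> ((real m ^ 3) ^ q * real (card \<T>) ^ (M - q)) * (27 ^ q * real (card \<T>) ^ q)"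
      unfolding 1 of_nat_mult using 2 3 by (intro mult_mono) auto
    also have "\<dots> = (27 * real m ^ 3) ^ q * (real (card \<T>) ^ (M - q) * real (card \<T>) ^ q)"
      by (simp add: power_mult_distrib)
    also have "real (card \<T>) ^ (M - q) * real (card \<T>) ^ q = real (card \<Omega>)"
      using qM by (simp add: c\<Omega> flip: power_add)
    finally show ?thesis .
  qed
  have cC: "card (C (Suc q)) \<le> n ^ Suc q * M ^ q" for q
  proof -
    have "C (Suc q) = nsets {..<n} (Suc q) \<times> nsets {..<M} q"
      by (auto simp: C_def nsets_def intro: finite_subset)
    then have "card (C (Suc q)) = (n choose Suc q) * (M choose q)"
      by (simp add: card_cartesian_product)
    also have "\<dots> \<le> n ^ Suc q * M ^ q"
    proof -
      have le: "a choose b \<le> a ^ b" for a b :: nat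
        by (cases "b \<le> a") (auto intro: binomial_le_pow simp: binomial_eq_0)
      show ?thesis by (intro mult_mono le) simp_all
    qed
    finally show ?thesis .
  qed
  have level: "(\<Sum>(W,Q)\<in>C q. real (card {T\<in>\<Omega>. \<forall>i\<in>Q. T i \<subseteq> W})) \<le> real n * K * real (card \<Omega>)"
    if "q \<le> m" for q
  proof (cases q)
    case 0
    then have "C q = {}" by (auto simp: C_def)
    then show ?thesis by (simp add: K_def)
  next
    case (Suc p)
    have n3: "real n ^ (3 * p) > 0" using assms(1) by simp
    have "(\<Sum>(W,Q)\<in>C q. real (card {T\<in>\<Omega>. \<forall>i\<in>Q. T i \<subseteq> W})) \<le>
        (\<Sum>(W,Q)\<in>C q. (27 * real m ^ 3) ^ p * real (card \<Omega>) / real n ^ (3 * p))"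
    proof (intro sum_mono, clarify)
      fix W Q assume "(W, Q) \<in> C q"
      then have "W \<subseteq> {..<n}" "card W \<le> m" "Q \<subseteq> {..<M}" "card Q = p"
        using that by (auto simp: C_def Suc)
      from prob[OF this] show "real (card {T\<in>\<Omega>. \<forall>i\<in>Q. T i \<subseteq> W})
          \<le> (27 * real m ^ 3) ^ p * real (card \<Omega>) / real n ^ (3 * p)"
        by (subst pos_le_divide_eq[OF n3])
    qed
    also have "\<dots> = real (card (C q)) * ((27 * real m ^ 3) ^ p * real (card \<Omega>) / real n ^ (3 * p))"
      by (simp add: case_prod_beta)
    also have "\<dots> \<le> real (n ^ Suc p * M ^ p) * ((27 * real m ^ 3) ^ p * real (card \<Omega>) / real n ^ (3 * p))"
      using cC[of p] unfolding Suc by (intro mult_right_mono) (simp_all only: of_nat_le_iff, simp)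
    also have "real (n ^ Suc p * M ^ p) = real n * real n ^ (3 * p)"
      by (simp add: M power_mult[symmetric] power_add[symmetric])
    also have "real n * real n ^ (3 * p) * ((27 * real m ^ 3) ^ p * real (card \<Omega>) / real n ^ (3 * p))
       = real n * (27 * real m ^ 3) ^ p * real (card \<Omega>)"
      using n3 by simp
    also have "\<dots> \<le> real n * K * real (card \<Omega>)"
    proof -
      have "(27 * real m ^ 3) ^ p \<le> (27 * real m ^ 3 + 1) ^ p" by (intro power_mono) auto
      also have "\<dots> \<le> K" unfolding K_def using that Suc by (intro power_increasing) auto
      finally show ?thesis by (intro mult_right_mono mult_left_mono) auto
    qed
    finally show ?thesis .
  qed
  have total: "(\<Sum>T\<in>\<Omega>. real (card (bad T))) \<le> real n * (real (m+1) * K) * real (card \<Omega>)"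
  proof -
    let ?P = "\<Union>q\<le>m. C q"
    have finP: "finite ?P" using finC by auto
    have "bad T = {p\<in>?P. \<forall>i\<in>snd p. T i \<subseteq> fst p}" for T
      by (auto simp: bad_def C_def) blast+
    then have "(\<Sum>T\<in>\<Omega>. card (bad T)) = (\<Sum>T\<in>\<Omega>. card {p\<in>?P. \<forall>i\<in>snd p. T i \<subseteq> fst p})"
      by simp
    also have "\<dots> = (\<Sum>p\<in>?P. card {T\<in>\<Omega>. \<forall>i\<in>snd p. T i \<subseteq> fst p})"
      using fin\<Omega> finP by (intro sum_multicount_gen) auto
    also have "\<dots> = (\<Sum>q\<le>m. \<Sum>p\<in>C q. card {T\<in>\<Omega>. \<forall>i\<in>snd p. T i \<subseteq> fst p})"
      using finC by (intro sum.UNION_disjoint) (auto simp: C_def)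
    finally have "(\<Sum>T\<in>\<Omega>. real (card (bad T))) =
        (\<Sum>q\<le>m. \<Sum>p\<in>C q. real (card {T\<in>\<Omega>. \<forall>i\<in>snd p. T i \<subseteq> fst p}))"
      by (simp flip: of_nat_sum)
    also have "\<dots> \<le> (\<Sum>q\<le>m. real n * K * real (card \<Omega>))"
      using level by (intro sum_mono) (simp add: case_prod_beta)
    finally show ?thesis by (simp add: algebra_simps)
  qed
  show ?thesis
  proof (rule ccontr)
    assume neg: "\<not> ?thesis"
    have "(\<Sum>T\<in>\<Omega>. real n * (real (m+1) * K)) < (\<Sum>T\<in>\<Omega>. real (card (bad T)))"
    proof (rule sum_strict_mono)
      show "finite \<Omega>" by (rule fin\<Omega>)
      show "\<Omega> \<noteq> {}" using posT c\<Omega> by (metis card.empty less_irrefl zero_less_power)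
      show "real n * (real (m+1) * K) < real (card (bad T))" if "T \<in> \<Omega>" for T
        using neg that unfolding \<Omega>_def bad_def K_def M \<T>_def by (meson not_le)
    qed
    then show False using total by (simp add: mult.commute)
  qed
qed

text \<open>The deletion method: removing one triple for each crowded set costs only \<open>O(n)\<close> of the \<open>n\<^sup>2 = 4 t\<^sup>2\<close>
triples. Two equal triples make their own vertex set crowded, so the remaining ones are distinct.\<close>

lemma ex_locally_sparse:
  fixes m :: nat
  shows "\<exists>t A. A \<subseteq> nsets {..<2 * t} 3 \<and> card A > 3 * t^2 \<and> t > 0 \<and>
     (\<forall>W \<subseteq> {..<2 * t}. card W \<le> m \<longrightarrow> card {e\<in>A. e \<subseteq> W} \<le> card W - 2)"
proof -
  \<comment> \<open>The bound \<open>m + 3\<close> in place of \<open>m\<close> lets three-element sets count as crowded even if \<open>m < 3\<close>, as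
    is needed for distinctness.\<close>
  define K where "K = real (m+4) * (27 * real (m+3) ^ 3 + 1) ^ (m+3)"
  have K: "K \<ge> 0" by (simp add: K_def)
  \<comment> \<open>Large enough for \<open>n K = 2 t K < t\<^sup>2\<close>, the number of triples that may be removed.\<close>
  define t where "t = nat \<lceil>2 * K\<rceil> + 2"
  define n where "n = 2 * t"
  define M where "M = n^2"
  have tK: "real t > 2 * K" unfolding t_def by linarith
  have n3: "n \<ge> 3" by (simp add: n_def t_def)
  obtain T where T: "T \<in> {..<M} \<rightarrow>\<^sub>E nsets {..<n} 3" and
    bad: "real (card {(W, Q). W \<subseteq> {..<n} \<and> card W \<le> m + 3 \<and> Q \<subseteq> {..<M} \<and> card Q + 1 = card W \<and>
       (\<forall>i\<in>Q. T i \<subseteq> W)}) \<le> real n * K"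
    using ex_triples_few_crowded_sets[OF n3, of "m+3", folded M_def] unfolding K_def by (auto simp: algebra_simps)
  define B where "B = {(W, Q). W \<subseteq> {..<n} \<and> card W \<le> m + 3 \<and> Q \<subseteq> {..<M} \<and> card Q + 1 = card W \<and>
       (\<forall>i\<in>Q. T i \<subseteq> W)}"
  have finB: "finite B"
    by (rule finite_subset[of _ "Pow {..<n} \<times> Pow {..<M}"]) (auto simp: B_def)
  \<comment> \<open>One index is removed for each crowded set.\<close>
  define D where "D = (\<lambda>(W, Q). SOME i. i \<in> Q) ` B"
  have "card D \<le> card B" unfolding D_def using finB by (rule card_image_le)
  then have cD: "real (card D) \<le> real n * K" using bad unfolding B_def by linarith
  have D: "\<exists>i\<in>Q. i \<in> D" if "W \<subseteq> {..<n}" "card W \<le> m + 3" "Q \<subseteq> {..<M}" "card Q + 1 = card W"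
    "\<forall>i\<in>Q. T i \<subseteq> W" "Q \<noteq> {}" for W Q
  proof -
    have "(W, Q) \<in> B" using that by (simp add: B_def)
    then have "(SOME i. i \<in> Q) \<in> D" unfolding D_def by force
    moreover have "(SOME i. i \<in> Q) \<in> Q" using that(6) some_in_eq by blast
    ultimately show ?thesis by blast
  qed
  define J where "J = {..<M} - D"
  have TJ: "T i \<subseteq> {..<n}" "card (T i) = 3" if "i \<in> J" for i
    using PiE_mem[OF T, of i] that by (auto simp: J_def nsets_def)
  have inj: "inj_on T J"
  proof (rule inj_onI, rule ccontr)
    fix i j assume ij: "i \<in> J" "j \<in> J" "T i = T j" "i \<noteq> j"
    have "\<exists>l\<in>{i,j}. l \<in> D"
      using ij TJ[of i] by (intro D[of "T i"]) (auto simp: J_def)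
    then show False using ij by (auto simp: J_def)
  qed
  define A where "A = T ` J"
  have "card A > 3 * t^2"
  proof -
    have "real n * K < real t * real t"
    proof -
      have "real n * K = real t * (2 * K)" by (simp add: n_def)
      also have "\<dots> < real t * real t" using tK K by (intro mult_strict_left_mono) auto
      finally show ?thesis .
    qed
    then have "real (card D) < real (t * t)" using cD by simp
    then have "card D < t * t" by (simp only: of_nat_less_iff)
    moreover have "M = 4 * (t * t)" by (simp add: M_def n_def power2_eq_square)
    moreover have "card J \<ge> M - card D"
      unfolding J_def using diff_card_le_card_Diff[of D "{..<M}"] finB by (simp add: D_def)
    moreover have "card A = card J" unfolding A_def using inj by (rule card_image)
    ultimately show ?thesis by (simp add: power2_eq_square)
  qed
  moreover have "card {e\<in>A. e \<subseteq> W} \<le> card W - 2" if W: "W \<subseteq> {..<2*t}" "card W \<le> m" for W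
  proof (rule ccontr)
    assume neg: "\<not> card {e\<in>A. e \<subseteq> W} \<le> card W - 2"
    have finW: "finite W" using W finite_subset by auto
    have "{e\<in>A. e \<subseteq> W} \<noteq> {}" using neg by force
    then obtain i where "i \<in> J" "T i \<subseteq> W" by (auto simp: A_def)
    then have W3: "card W \<ge> 3" using TJ(2)[of i] card_mono[OF finW, of "T i"] by simp
    have "{e\<in>A. e \<subseteq> W} = T ` {i\<in>J. T i \<subseteq> W}" by (auto simp: A_def)
    then have "card {e\<in>A. e \<subseteq> W} = card {i\<in>J. T i \<subseteq> W}"
      using inj by (simp add: card_image inj_on_subset)
    then have "card W - 1 \<le> card {i\<in>J. T i \<subseteq> W}" using neg W3 by linarith
    then obtain Q where Q: "Q \<subseteq> {i\<in>J. T i \<subseteq> W}" "card Q = card W - 1"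
      by (rule obtain_subset_with_card_n)
    have "\<exists>i\<in>Q. i \<in> D"
      using W W3 Q by (intro D[of W Q]) (auto simp: n_def J_def)
    then show False using Q by (auto simp: J_def)
  qed
  moreover have "A \<subseteq> nsets {..<2 * t} 3"
    using TJ by (auto simp: A_def nsets_def n_def intro: finite_subset)
  moreover have "t > 0" by (simp add: t_def)
  ultimately show ?thesis by blast
qed

text \<open>A sum of natural numbers is the sum over all thresholds of the number of summands that reach them.\<close>

lemma card_thresholds_le_imp_sum_le:
  fixes f :: "'a \<Rightarrow> nat" and g :: "'b \<Rightarrow> nat"
  assumes fin: "finite A" "finite B"
    and le: "\<And>\<tau>. \<tau> \<ge> 1 \<Longrightarrow> card {a\<in>A. f a \<ge> \<tau>} \<le> card {b\<in>B. g b \<ge> \<tau>}"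
  shows "sum f A \<le> sum g B"
proof -
  have layer: "sum h C = (\<Sum>\<tau>=1..N. card {c\<in>C. h c \<ge> \<tau>})"
    if "finite C" "\<And>c. c \<in> C \<Longrightarrow> h c \<le> N" for h :: "'c \<Rightarrow> nat" and C N
  proof -
    have "{\<tau>\<in>{1..N}. \<tau> \<le> h c} = {1..h c}" if "c \<in> C" for c
      using \<open>\<And>c. c \<in> C \<Longrightarrow> h c \<le> N\<close>[OF that] by auto
    then have "sum h C = (\<Sum>c\<in>C. card {\<tau>\<in>{1..N}. \<tau> \<le> h c})" by simp
    also have "\<dots> = (\<Sum>\<tau>=1..N. card {c\<in>C. h c \<ge> \<tau>})"
      using that(1) by (intro sum_multicount_gen) auto
    finally show ?thesis .
  qed
  define N where "N = sum f A + sum g B"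
  have "f a \<le> N" if "a \<in> A" for a
    using member_le_sum[OF that, of f] fin by (simp add: N_def)
  moreover have "g b \<le> N" if "b \<in> B" for b
    using member_le_sum[OF that, of g] fin by (simp add: N_def)
  ultimately show ?thesis
    using layer[of A f N] layer[of B g N] fin le by (auto intro!: sum_mono)
qed


text \<open>The sparse triples weigh no more than if all of them contained the two heaviest vertices. Let \<open>a\<close> and
\<open>b\<close> be the weights of these two. A triple weighs at most \<open>a b\<close> times its minimal weight, and the
triples of minimal weight at least \<open>\<tau>\<close> live on the vertices of weight at least \<open>\<tau>\<close>; by sparseness
there are at most as many of them as of these vertices other than the two heaviest. So the minimal
weights of the triples sum up to at most the total weight of the remaining vertices.\<close>

lemma lagr_locally_sparse_le:
  fixes x :: "'a \<Rightarrow> nat"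
  assumes V: "finite V" and A: "A \<subseteq> nsets V 3"
    and sparse: "\<And>W. W \<subseteq> V \<Longrightarrow> card W \<le> m \<Longrightarrow> card {e\<in>A. e \<subseteq> W} \<le> card W - 2"
    and supp: "card {v\<in>V. x v > 0} \<le> m"
  shows "\<exists>a b. a + b \<le> sum x V \<and> a^2 + b^2 \<le> (\<Sum>v\<in>V. (x v)^2) \<and>
           lagr A x \<le> a * b * (sum x V - a - b)"
proof (cases "A = {}")
  case True
  then show ?thesis by (intro exI[of _ 0]) (simp add: lagr_def)
next
  case False
  have finA: "finite A" using A V by (meson finite_imp_finite_nsets finite_subset)
  obtain e0 where "e0 \<in> A" using False by blast
  then have "3 \<le> card V" using A card_mono[OF V, of e0] by (auto simp: nsets_def)
  define u where "u = (ARG_MAX x v. v \<in> V)"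
  define v where "v = (ARG_MAX x v. v \<in> V - {u})"
  have Vne: "V \<noteq> {}" using \<open>3 \<le> card V\<close> by auto
  have bound: "\<forall>y. y \<in> V \<longrightarrow> x y < sum x V + 1"
    using V member_le_sum[of _ V x] by (simp add: less_Suc_eq_le)
  have u: "u \<in> V" "\<And>i. i \<in> V \<Longrightarrow> x i \<le> x u"
    using arg_max_nat_lemma[of "\<lambda>i. i \<in> V" _ x "sum x V + 1"] Vne bound
    unfolding u_def by blast+
  have "card (V - {u}) \<ge> 2" using u \<open>3 \<le> card V\<close> by simp
  then have "V - {u} \<noteq> {}" by force
  then have v: "v \<in> V" "v \<noteq> u" "\<And>i. i \<in> V \<Longrightarrow> i \<noteq> u \<Longrightarrow> x i \<le> x v"
    using arg_max_nat_lemma[of "\<lambda>i. i \<in> V - {u}" _ x "sum x V + 1"] bound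
    unfolding v_def by blast+
  define R where "R = V - {u, v}"
  have Vsplit: "V = insert u (insert v R)" "u \<notin> insert v R" "v \<notin> R" "finite R"
    using u v V by (auto simp: R_def)
  have sumV: "sum x V = x u + (x v + sum x R)" using Vsplit(2-4) by (subst Vsplit(1)) simp
  have sqV: "(\<Sum>i\<in>V. (x i)^2) = (x u)^2 + ((x v)^2 + (\<Sum>i\<in>R. (x i)^2))"
    using Vsplit(2-4) by (subst Vsplit(1)) simp
  define g where "g e = Min (x ` e)" for e
  have edge: "finite e" "e \<noteq> {}" "e \<subseteq> V" if "e \<in> A" for e
    using A that by (auto simp: nsets_def)
  have two: "x i * x j \<le> x u * x v" if "i \<in> V" "j \<in> V" "i \<noteq> j" for i j
  proof (cases "i = u")
    case True
    then show ?thesis using that v(3)[of j] by simp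
  next
    case False
    then show ?thesis using that v(3)[of i] u(2)[of j] mult_mono[of "x i" "x v" "x j" "x u"]
      by (simp add: mult.commute)
  qed
  have prod_le: "(\<Prod>i\<in>e. x i) \<le> x u * x v * g e" if e: "e \<in> A" for e
  proof -
    have "g e \<in> x ` e" unfolding g_def using edge[OF e] by (intro Min_in) auto
    then obtain k where k: "k \<in> e" "g e = x k" by blast
    have "card (e - {k}) = 2" using A e k by (auto simp: nsets_def)
    then obtain i j where ij: "e - {k} = {i, j}" "i \<noteq> j" by (auto simp: card_2_iff)
    have "(\<Prod>i\<in>e. x i) = x k * (\<Prod>i\<in>e - {k}. x i)"
      using k edge[OF e] by (intro prod.remove) auto
    also have "\<dots> = x k * (x i * x j)" using ij by simp
    also have "\<dots> \<le> x k * (x u * x v)"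
      using two[of i j] ij edge[OF e] by (intro mult_left_mono) auto
    finally show ?thesis using k by (simp add: mult.commute)
  qed
  have "sum g A \<le> sum x R"
  proof (rule card_thresholds_le_imp_sum_le[OF finA Vsplit(4)])
    fix \<tau> :: nat assume \<tau>: "\<tau> \<ge> 1"
    define W where "W = {i\<in>V. x i \<ge> \<tau>}"
    have heavy: "{e\<in>A. g e \<ge> \<tau>} = {e\<in>A. e \<subseteq> W}"
      using edge by (auto simp: W_def g_def)
    show "card {e\<in>A. g e \<ge> \<tau>} \<le> card {i\<in>R. x i \<ge> \<tau>}"
    proof (cases "{e\<in>A. e \<subseteq> W} = {}")
      case True
      show ?thesis unfolding heavy True by simp
    next
      case False
      then obtain e where e: "e \<in> A" "e \<subseteq> W" by blast
      have "card e = 3" using A e by (auto simp: nsets_def)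
      then have "card (e - {u}) \<ge> 2" using edge[OF e(1)] by (simp add: card_Diff_singleton_if)
      then have "e - {u} \<noteq> {}" by force
      then obtain j where "j \<in> e" "j \<noteq> u" by blast
      then have "u \<in> W" "v \<in> W" using e(2) u v by (auto simp: W_def intro: order_trans)
      then have WR: "W = insert u (insert v {i\<in>R. x i \<ge> \<tau>})" by (auto simp: W_def R_def)
      have "card W = card {i\<in>R. x i \<ge> \<tau>} + 2"
        unfolding WR using Vsplit(2-4) by simp
      moreover have "card W \<le> m"
      proof -
        have "card W \<le> card {v\<in>V. x v > 0}" using V \<tau> by (intro card_mono) (auto simp: W_def)
        then show ?thesis using supp by simp
      qed
      ultimately show ?thesis using heavy sparse[of W] by (simp add: W_def)
    qed
  qed
  have "lagr A x \<le> (\<Sum>e\<in>A. x u * x v * g e)" unfolding lagr_def by (intro sum_mono prod_le)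
  also have "\<dots> = x u * x v * sum g A" by (simp add: sum_distrib_left)
  also have "\<dots> \<le> x u * x v * sum x R" using \<open>sum g A \<le> sum x R\<close> by simp
  finally have "lagr A x \<le> x u * x v * (sum x V - x u - x v)" by (simp add: sumV)
  then show ?thesis by (intro exI[of _ "x u"] exI[of _ "x v"]) (simp add: sumV sqV)
qed

section \<open>The pattern on three parts\<close>

text \<open>The triples meeting \<open>(V1, V2, V3)\<close> in \<open>(1, 1, 1)\<close>, \<open>(2, 1, 0)\<close> or \<open>(0, 2, 1)\<close> vertices, and the extra
triples \<open>A\<close>, which are meant to lie inside \<open>V1\<close>.\<close>

definition triple_pattern :: "'a set \<Rightarrow> 'a set \<Rightarrow> 'a set \<Rightarrow> 'a set set \<Rightarrow> 'a set set" where
  "triple_pattern V1 V2 V3 A =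
     join (nsets V1 1) (join (nsets V2 1) (nsets V3 1)) \<union> join (nsets V1 2) (nsets V2 1) \<union>
     join (nsets V2 2) (nsets V3 1) \<union> A"

context
  fixes V1 V2 V3 :: "'a set" and A
  assumes fin: "finite V1" "finite V2" "finite V3"
    and disj: "V1 \<inter> V2 = {}" "V1 \<inter> V3 = {}" "V2 \<inter> V3 = {}"
    and A: "A \<subseteq> nsets V1 3"
begin

lemma
  shows triple_pattern_nsets: "triple_pattern V1 V2 V3 A \<subseteq> nsets (V1 \<union> V2 \<union> V3) 3"
    and lagr_triple_pattern: "lagr (triple_pattern V1 V2 V3 A) x =
      sum x V1 * (sum x V2 * sum x V3) + lagr (nsets V1 2) x * sum x V2 +
      lagr (nsets V2 2) x * sum x V3 + lagr A x"
proof -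
  define F1 where "F1 = join (nsets V1 1) (join (nsets V2 1) (nsets V3 1))"
  define F2 where "F2 = join (nsets V1 2) (nsets V2 1)"
  define F3 where "F3 = join (nsets V2 2) (nsets V3 1)"
  have d: "V1 \<inter> (V2 \<union> V3) = {}" using disj by auto
  have F0: "join (nsets V2 1) (nsets V3 1) \<subseteq> nsets (V2 \<union> V3) (1 + 1)"
    by (intro join_nsets subset_refl disj)
  have F: "F1 \<subseteq> nsets (V1 \<union> (V2 \<union> V3)) (1 + (1 + 1))" "F2 \<subseteq> nsets (V1 \<union> V2) (2 + 1)"
    "F3 \<subseteq> nsets (V2 \<union> V3) (2 + 1)"
    unfolding F1_def F2_def F3_def by (intro join_nsets subset_refl disj d F0)+
  have "nsets (V1 \<union> (V2 \<union> V3)) (1 + (1 + 1)) \<subseteq> nsets (V1 \<union> V2 \<union> V3) 3"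
    "nsets (V1 \<union> V2) (2 + 1) \<subseteq> nsets (V1 \<union> V2 \<union> V3) 3"
    "nsets (V2 \<union> V3) (2 + 1) \<subseteq> nsets (V1 \<union> V2 \<union> V3) 3"
    "nsets V1 3 \<subseteq> nsets (V1 \<union> V2 \<union> V3) 3"
    by (auto simp: nsets_def)
  with F A have F': "F1 \<subseteq> nsets (V1 \<union> V2 \<union> V3) 3" "F2 \<subseteq> nsets (V1 \<union> V2 \<union> V3) 3"
    "F3 \<subseteq> nsets (V1 \<union> V2 \<union> V3) 3" "A \<subseteq> nsets (V1 \<union> V2 \<union> V3) 3"
    by blast+
  have eq: "triple_pattern V1 V2 V3 A = F1 \<union> F2 \<union> F3 \<union> A"
    by (simp add: triple_pattern_def F1_def F2_def F3_def)
  show "triple_pattern V1 V2 V3 A \<subseteq> nsets (V1 \<union> V2 \<union> V3) 3" using F' by (simp add: eq)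
  \<comment> \<open>The four families of triples are told apart by the number of vertices in \<open>V1\<close>.\<close>
  have c1: "card (e \<inter> V1) = 1" if "e \<in> F1" for e
    using that unfolding F1_def by (rule card_Int_join) (rule subset_refl F0 d)+
  have c2: "card (e \<inter> V1) = 2" if "e \<in> F2" for e
    using that unfolding F2_def by (rule card_Int_join) (rule subset_refl disj)+
  have c3: "card (e \<inter> V1) = 0" if "e \<in> F3" for e
  proof -
    have "e \<inter> V1 = {}" using that F(3) d by (auto simp: nsets_def)
    then show ?thesis by simp
  qed
  have c4: "card (e \<inter> V1) = 3" if "e \<in> A" for e
  proof -
    have "e \<inter> V1 = e" "card e = 3" using that A by (auto simp: nsets_def)
    then show ?thesis by simp
  qed
  have dF: "F1 \<inter> F2 = {}" "(F1 \<union> F2) \<inter> F3 = {}" "(F1 \<union> F2 \<union> F3) \<inter> A = {}"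
    using c1 c2 c3 c4 by fastforce+
  have "finite (nsets (V1 \<union> V2 \<union> V3) 3)" using fin by (intro finite_imp_finite_nsets) auto
  then have finF: "finite F1" "finite F2" "finite F3" "finite A"
    using F' by (auto intro: finite_subset)
  have "lagr (triple_pattern V1 V2 V3 A) x = lagr F1 x + lagr F2 x + lagr F3 x + lagr A x"
    unfolding eq using dF finF by (simp add: lagr_Un)
  also have "lagr F1 x = sum x V1 * (sum x V2 * sum x V3)"
    unfolding F1_def lagr_join[OF subset_refl F0 d] lagr_join[OF subset_refl subset_refl disj(3)]
    by (simp only: lagr_singletons)
  also have "lagr F2 x = lagr (nsets V1 2) x * sum x V2"
    unfolding F2_def lagr_join[OF subset_refl subset_refl disj(1)] by (simp only: lagr_singletons)
  also have "lagr F3 x = lagr (nsets V2 2) x * sum x V3"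
    unfolding F3_def lagr_join[OF subset_refl subset_refl disj(3)] by (simp only: lagr_singletons)
  finally show "lagr (triple_pattern V1 V2 V3 A) x =
      sum x V1 * (sum x V2 * sum x V3) + lagr (nsets V1 2) x * sum x V2 +
      lagr (nsets V2 2) x * sum x V3 + lagr A x" .
qed

text \<open>Compared with the polynomial of the three parts, the extra triples gain at most \<open>a b (x - a - b)\<close>,
where \<open>x\<close> is the weight of \<open>V1\<close> and \<open>a\<close>, \<open>b\<close> are the two largest weights in it, and the missing pairs
of equal vertices in \<open>V1\<close> cost at least \<open>(a\<^sup>2 + b\<^sup>2)/2\<close> times the weight of \<open>V2\<close>. This is the
situation of \<open>pattern_with_gain_le\<close>.\<close>

lemma lagr_triple_pattern_le:
  assumes "\<And>W. W \<subseteq> V1 \<Longrightarrow> card W \<le> m \<Longrightarrow> card {e\<in>A. e \<subseteq> W} \<le> card W - 2"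
    and "card {v\<in>V1. x v > 0} \<le> m"
  shows "real (lagr (triple_pattern V1 V2 V3 A) x) \<le> 2/25 * real (sum x V1 + sum x V2 + sum x V3) ^ 3"
proof -
  obtain a b where ab: "a + b \<le> sum x V1" "a^2 + b^2 \<le> (\<Sum>v\<in>V1. (x v)^2)"
    "lagr A x \<le> a * b * (sum x V1 - a - b)"
    using lagr_locally_sparse_le[OF fin(1) A assms(1,2)] by blast
  define X Y Z where "X = real (sum x V1)" and "Y = real (sum x V2)" and "Z = real (sum x V3)"
  have nn: "X \<ge> 0" "Y \<ge> 0" "Z \<ge> 0" unfolding X_def Y_def Z_def by (rule of_nat_0_le_iff)+
  have "2 * lagr (nsets V1 2) x + (a^2 + b^2) \<le> (sum x V1)^2"
    using lagr_pairs[OF fin(1), of x] ab(2) by linarith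
  then have "real (2 * lagr (nsets V1 2) x + (a^2 + b^2)) \<le> real ((sum x V1)^2)"
    by (simp only: of_nat_le_iff)
  then have 1: "real (lagr (nsets V1 2) x) \<le> (X^2 - (real a^2 + real b^2)) / 2"
    by (simp add: X_def)
  have "2 * lagr (nsets V2 2) x \<le> (sum x V2)^2"
    using lagr_pairs[OF fin(2), of x] by linarith
  then have "real (2 * lagr (nsets V2 2) x) \<le> real ((sum x V2)^2)"
    by (simp only: of_nat_le_iff)
  then have 2: "real (lagr (nsets V2 2) x) \<le> Y^2 / 2" by (simp add: Y_def)
  have "real (lagr A x) \<le> real (a * b * (sum x V1 - a - b))" using ab(3) by (simp only: of_nat_le_iff)
  then have 3: "real (lagr A x) \<le> real a * real b * (X - real a - real b)"
    using ab(1) by (simp add: X_def of_nat_diff diff_diff_eq)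
  have "real (lagr (triple_pattern V1 V2 V3 A) x) =
      X * Y * Z + real (lagr (nsets V1 2) x) * Y + real (lagr (nsets V2 2) x) * Z + real (lagr A x)"
    by (simp add: lagr_triple_pattern X_def Y_def Z_def)
  also have "\<dots> \<le> X * Y * Z + (X^2 - (real a^2 + real b^2)) / 2 * Y + Y^2 / 2 * Z
      + real a * real b * (X - real a - real b)"
    using 1 2 3 nn by (intro add_mono mult_right_mono order_refl)
  also have "\<dots> \<le> 2/25 * (X + Y + Z) ^ 3"
    using pattern_with_gain_le[of X Y Z a b] nn by simp
  finally show ?thesis by (simp add: X_def Y_def Z_def)
qed

end

section \<open>Passing to larger edges\<close>

text \<open>The inequality of arithmetic and geometric means for the numbers \<open>x j\<close> and three copies of \<open>S / 3\<close>.
It bounds the weight of \<open>r\<close>-sets that consist of one fixed set \<open>B\<close> and a triple: the \<open>r - 3\<close> vertices of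
\<open>B\<close> should get a fraction \<open>1 / r\<close> of the weight each, and the triples \<open>3 / r\<close> in total.\<close>

lemma prod_mult_cube_le:
  fixes x :: "'a \<Rightarrow> real"
  assumes B: "finite B" "card B + 3 = r" and "\<And>j. j \<in> B \<Longrightarrow> x j \<ge> 0" "S \<ge> 0"
  shows "(\<Prod>j\<in>B. x j) * S ^ 3 * real r ^ r \<le> 27 * (sum x B + S) ^ r"
proof -
  \<comment> \<open>The index set is \<open>B\<close> together with three further points.\<close>
  define f where "f = case_sum x (\<lambda>_::nat. S / 3)"
  define J where "J = B <+> {..<3::nat}"
  have J: "finite J" "J \<noteq> {}" "card J = r" "r > 0"
    using B by (auto simp: J_def card_Plus lessThan_empty_iff)
  have nn: "f i \<ge> 0" if "i \<in> J" for i
    using that assms by (auto simp: J_def f_def)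
  have p: "prod f J = prod x B * (S/3)^3"
    using B by (simp add: f_def J_def prod.Plus comp_def)
  have s: "sum f J = sum x B + S"
    using B by (simp add: f_def J_def sum.Plus comp_def)
  have P: "prod f J \<ge> 0" using nn by (intro prod_nonneg) auto
  have "prod f J powr (1 / r) \<le> sum f J / r"
    using arith_geom_mean[of J f] nn J by (simp flip: sum_divide_distrib)
  then have "(prod f J powr (1 / r)) ^ r \<le> (sum f J / r) ^ r"
    by (intro power_mono) auto
  also have "(prod f J powr (1 / r)) ^ r = prod f J"
    using P J by (cases "prod f J = 0") (simp_all add: powr_power del: prod_zero_iff)
  finally have "prod x B * (S/3)^3 \<le> (sum x B + S) ^ r / real r ^ r"
    unfolding p s by (simp add: power_divide)
  then show ?thesis using J by (simp add: pos_le_divide_eq power_divide)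
qed

lemma fact_le_power_self: "r \<ge> 3 \<Longrightarrow> 9 * fact r \<le> 2 * real r ^ r"
proof (induction r rule: dec_induct)
  case base
  then show ?case by (simp add: fact_numeral)
next
  case (step r)
  have "9 * fact (Suc r) = real (Suc r) * (9 * fact r)" by simp
  also have "\<dots> \<le> real (Suc r) * (2 * real r ^ r)" using step by (intro mult_left_mono) auto
  also have "\<dots> \<le> real (Suc r) * (2 * real (Suc r) ^ r)"
    by (intro mult_left_mono power_mono) auto
  finally show ?case by simp
qed

theorem corollary1p4:
  fixes r :: nat
  assumes "r \<ge> 3"
  shows "non_jump r (54 * fact r / (25 * real r ^ r))"
proof (rule non_jumpI[where 'a = nat])
  show "2 \<le> r" using assms by simp
  show "0 \<le> 54 * fact r / (25 * real r ^ r)" by simp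
  have rr: "real r ^ r > 0" using assms by simp
  then have "54 * fact r < 25 * real r ^ r"
    using fact_le_power_self[OF assms] by linarith
  then show "54 * fact r / (25 * real r ^ r) < 1" using rr by simp
next
  fix m
  obtain t A where A: "A \<subseteq> nsets {..<2 * t} 3" "card A > 3 * t^2" "t > 0" and
    sparse: "\<And>W. W \<subseteq> {..<2 * t} \<Longrightarrow> card W \<le> m \<Longrightarrow> card {e\<in>A. e \<subseteq> W} \<le> card W - 2"
    using ex_locally_sparse[of m] by blast
  define V1 V2 V3 where "V1 = {..<2*t}" and "V2 = {2*t..<4*t}" and "V3 = {4*t..<5*t}"
  define B where "B = {5*t..<5*t+(r-3)}"
  define U where "U = V1 \<union> V2 \<union> V3"
  define E3 where "E3 = triple_pattern V1 V2 V3 A"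
  define I where "I = U \<union> B"
  define E where "E = join E3 {B}"
  \<comment> \<open>These weights are proportional to the optimal ones: \<open>15 t\<close> in total for the \<open>5 t\<close> vertices of \<open>U\<close>,
    and \<open>5 t\<close> for each of the \<open>r - 3\<close> vertices of \<open>B\<close>.\<close>
  define w where "w i = (if i < 5 * t then 3 else 5 * t)" for i :: nat
  have fin: "finite V1" "finite V2" "finite V3" and
    disj: "V1 \<inter> V2 = {}" "V1 \<inter> V3 = {}" "V2 \<inter> V3 = {}" and AV: "A \<subseteq> nsets V1 3"
    using A(1) by (auto simp: V1_def V2_def V3_def)
  have B: "finite B" "card B + 3 = r" "card B = r - 3" "U \<inter> B = {}"
    using assms by (auto simp: B_def U_def V1_def V2_def V3_def)
  have finI: "finite I" using fin B(1) by (simp add: I_def U_def)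
  have E3: "E3 \<subseteq> nsets U 3"
    unfolding E3_def U_def by (rule triple_pattern_nsets[OF fin disj AV])
  have BB: "{B} \<subseteq> nsets B (r - 3)" using B by (simp add: nsets_def)
  have EI: "E \<subseteq> nsets I r"
    using join_nsets[OF E3 BB B(4)] assms by (simp add: E_def I_def)
  have lagrE: "lagr E x = lagr E3 x * prod x B" for x
    unfolding E_def lagr_join[OF E3 BB B(4)] by (simp add: lagr_def)
  have sumI: "sum x I = sum x V1 + sum x V2 + sum x V3 + sum x B" for x :: "nat \<Rightarrow> nat"
  proof -
    have "sum x U = sum x V1 + sum x V2 + sum x V3"
      using fin disj unfolding U_def by (subst sum.union_disjoint, auto)+
    moreover have "sum x I = sum x U + sum x B"
      using fin B unfolding I_def by (intro sum.union_disjoint) (auto simp: U_def)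
    ultimately show ?thesis by simp
  qed
  let ?\<alpha> = "54 * fact r / (25 * real r ^ r)"
  have rr: "real r ^ r > 0" using assms by simp
  have "?\<alpha> * real (sum w I) ^ r < fact r * real (lagr E w)"
  proof -
    have w3: "w i = 3" if "i \<in> V1 \<union> V2 \<union> V3" for i
      using that by (auto simp: w_def V1_def V2_def V3_def)
    have wV: "sum w V1 = 6 * t" "sum w V2 = 6 * t" "sum w V3 = 3 * t"
      using w3 by (simp_all add: V1_def V2_def V3_def)
    have wB: "w i = 5 * t" if "i \<in> B" for i using that by (simp add: w_def B_def)
    have sq: "(\<Sum>i\<in>V1. (w i)^2) = 18 * t" "(\<Sum>i\<in>V2. (w i)^2) = 18 * t"
      using w3 by (simp_all add: V1_def V2_def)
    have "2 * lagr (nsets V1 2) w + 18 * t = (6 * t)^2"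
      using lagr_pairs[OF fin(1), of w] by (simp add: wV sq)
    then have "real (2 * lagr (nsets V1 2) w + 18 * t) = real ((6 * t)^2)" by (simp only:)
    then have p1: "real (lagr (nsets V1 2) w) = 18 * real t ^ 2 - 9 * real t"
      by (simp add: power_mult_distrib)
    have "2 * lagr (nsets V2 2) w + 18 * t = (6 * t)^2"
      using lagr_pairs[OF fin(2), of w] by (simp add: wV sq)
    then have "real (2 * lagr (nsets V2 2) w + 18 * t) = real ((6 * t)^2)" by (simp only:)
    then have p2: "real (lagr (nsets V2 2) w) = 18 * real t ^ 2 - 9 * real t"
      by (simp add: power_mult_distrib)
    have "(\<Prod>i\<in>e. w i) = 27" if "e \<in> A" for e
    proof -
      have "e \<subseteq> V1" "card e = 3" using that AV by (auto simp: nsets_def)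
      then have "(\<Prod>i\<in>e. w i) = (\<Prod>i\<in>e. 3)" using w3 by (intro prod.cong) auto
      then show ?thesis using \<open>card e = 3\<close> by simp
    qed
    then have lA: "lagr A w = 27 * card A" by (simp add: lagr_def)
    \<comment> \<open>The loss \<open>81 t\<^sup>2\<close> of the pairs inside \<open>V1\<close> and \<open>V2\<close> is outweighed because \<open>A\<close> has more than
      \<open>3 t\<^sup>2\<close> triples.\<close>
    have "real (lagr E3 w) = 270 * real t ^ 3 - 81 * real t ^ 2 + 27 * real (card A)"
      unfolding E3_def lagr_triple_pattern[OF fin disj AV] of_nat_add of_nat_mult p1 p2 wV lA
      by (simp add: power2_eq_square power3_eq_cube algebra_simps)
    moreover have "real (card A) > 3 * real t ^ 2"
      using A(2) by (metis of_nat_less_iff of_nat_mult of_nat_numeral of_nat_power)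
    ultimately have l3: "real (lagr E3 w) > 270 * real t ^ 3" by linarith
    have "prod w B = (5 * t) ^ (r - 3)" using wB B by simp
    then have lE: "real (lagr E w) = real (lagr E3 w) * (5 * real t) ^ (r - 3)"
      by (simp add: lagrE)
    have "sum w B = (r - 3) * (5 * t)" using wB B by simp
    then have "sum w I = (card B + 3) * (5 * t)" by (simp add: sumI wV B(3) algebra_simps)
    then have sI: "sum w I = r * (5 * t)" unfolding B(2) .
    have "?\<alpha> * real (sum w I) ^ r = fact r * (54/25 * (5 * real t) ^ r)"
      using rr by (simp add: sI power_mult_distrib)
    also have "(5 * real t) ^ r = (5 * real t) ^ (r - 3) * (5 * real t) ^ 3"
      using assms by (simp only: power_add[symmetric]) simp
    also have "fact r * (54/25 * ((5 * real t) ^ (r - 3) * (5 * real t) ^ 3)) =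
        fact r * (270 * real t ^ 3 * (5 * real t) ^ (r - 3))"
      by (simp add: power_mult_distrib)
    also have "\<dots> < fact r * (real (lagr E3 w) * (5 * real t) ^ (r - 3))"
      using l3 A(3) by (intro mult_strict_left_mono mult_strict_right_mono) auto
    finally show ?thesis by (simp add: lE)
  qed
  moreover have "fact r * real (lagr E x) \<le> ?\<alpha> * real (sum x I) ^ r"
    if x: "card {i\<in>I. x i > 0} \<le> m" for x
  proof -
    have "card {v\<in>V1. x v > 0} \<le> card {i\<in>I. x i > 0}"
      using finI by (intro card_mono) (auto simp: I_def U_def)
    then have "card {v\<in>V1. x v > 0} \<le> m" using x by simp
    note le3 = lagr_triple_pattern_le[OF fin disj AV sparse[folded V1_def] this]
    define S where "S = real (sum x V1 + sum x V2 + sum x V3)"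
    have "real (lagr E x) \<le> 2/25 * S ^ 3 * real (prod x B)"
      unfolding lagrE of_nat_mult S_def E3_def by (intro mult_right_mono le3 of_nat_0_le_iff)
    then have "real (lagr E x) * real r ^ r \<le> 2/25 * S ^ 3 * real (prod x B) * real r ^ r"
      using rr by (intro mult_right_mono) auto
    also have "\<dots> = 2/25 * ((\<Prod>j\<in>B. real (x j)) * S ^ 3 * real r ^ r)" by simp
    also have "\<dots> \<le> 2/25 * (27 * ((\<Sum>j\<in>B. real (x j)) + S) ^ r)"
    proof (rule mult_left_mono)
      have "0 \<le> S" unfolding S_def by (rule of_nat_0_le_iff)
      then show "(\<Prod>j\<in>B. real (x j)) * S ^ 3 * real r ^ r \<le> 27 * ((\<Sum>j\<in>B. real (x j)) + S) ^ r"
        by (intro prod_mult_cube_le B) auto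
    qed simp
    also have "(\<Sum>j\<in>B. real (x j)) + S = real (sum x I)" by (simp add: sumI S_def)
    finally have "real (lagr E x) \<le> 54 / 25 * real (sum x I) ^ r / real r ^ r"
      using rr by (simp add: pos_le_divide_eq)
    then have "fact r * real (lagr E x) \<le> fact r * (54 / 25 * real (sum x I) ^ r / real r ^ r)"
      by (intro mult_left_mono) auto
    then show ?thesis by (simp add: mult_ac)
  qed
  ultimately show "\<exists>(I :: nat set) E w. finite I \<and> E \<subseteq> nsets I r \<and>
      ?\<alpha> * real (sum w I) ^ r < fact r * real (lagr E w) \<and>
      (\<forall>x. card {i\<in>I. x i > 0} \<le> m \<longrightarrow> fact r * real (lagr E x) \<le> ?\<alpha> * real (sum x I) ^ r)"
    using finI EI by blast
qed

end
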